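(* Let $\mathbb F$ be a finite field with $q$ elements, $A=\mathbb F[t]$, and let $r,d$ be positive integers with $r\ge d+\log_q(2d)$. Let $\Omega_r$ be the (finite) set of all small Drinfeld models $\phi:A\to A\{\tau\}$ of rank at most $r$, equipped with the uniform probability distribution. Then for every place $\mathfrak p$ of $A$ of degree $d$, the probability that $\mathfrak p$ is $\phi$-Wieferich in base $1$ (for $\phi$ uniformly random in $\Omega_r$) equals $q^{-d}$.
   Context: $A\{\tau\}$ is the ring of twisted polynomials $\sum c_i\tau^i$ ($c_i\in A$) with $\tau c=c^q\tau$, acting on $A$ by $(\sum c_i\tau^i)(x)=\sum c_ix^{q^i}$. A Drinfeld model of rank $r\ge1$ is an $\mathbb F$-algebra homomorphism $\phi:A\to A\{\tau\}$ with $\phi_t=t+g_1\tau+\cdots+g_r\tau^r$, $g_i\in A$, $g_r\ne0$; it is small if $\deg_tg_i\le q^i$ for all $i$. A place is a monic irreducible polynomial of $A$. For $x\in A$ and an ideal $I$, $\pi_x(\phi;I)=\{a\in A:\phi_a(x)\in I\}$; $\mathfrak p$ is $\phi$-Wieferich in base $x$ if $\pi_x(\phi;\mathfrak p)=\pi_x(\phi;\mathfrak p^2)$.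
   Formalization: Here Ω_r also contains the degenerate model φ_t = t (rank 0), so it corresponds to all tuples (g_1,…,g_r) with deg g_i ≤ q^i; with only models of rank ≥ 1, |Ω_r| = q^M − 1 is prime to q and the probability could never equal q^{-d}. *)

theory Defs
  imports "HOL-Computational_Algebra.Computational_Algebra" "HOL-Probability.Probability"
begin

lemma of_nat_CARD_choose_eq_0:
  assumes "0 < i" "i < CARD('f)"
  shows "(of_nat (CARD('f) choose i) :: 'f :: finite_field) = 0"
proof -
  define q where "q = CARD('f)"
  define p :: "'f poly" where "p = (\<Sum>i=1..<q. monom (of_nat (q choose i)) i)"
  have q: "q > 0" by (simp add: q_def finite_UNIV_card_ge_0)
  have root: "poly p x = 0" for x :: 'f
  proof -
    have "{..q} = insert 0 (insert q {1..<q})" using q by auto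
    then have "(x + 1) ^ q = 1 + x ^ q + poly p x"
      using q by (simp add: binomial_ring p_def poly_sum poly_monom)
    moreover have "(x + 1) ^ q = x + 1" "x ^ q = x"
      by (simp_all add: q_def finite_field_power_card_eq_same)
    ultimately show ?thesis by simp
  qed
  have "p = 0"
  proof (rule ccontr)
    assume "p \<noteq> 0"
    have "degree p \<le> q - 1"
      unfolding p_def by (rule degree_sum_le) (auto intro!: order.trans[OF degree_monom_le])
    moreover have "card {x. poly p x = 0} \<le> degree p"
      using \<open>p \<noteq> 0\<close> by (rule card_poly_roots_bound)
    moreover have "card {x. poly p x = 0} = q" using root by (simp add: q_def)
    ultimately show False using q by linarith
  qed
  then have "coeff p i = 0" by simp
  then show ?thesis using assms
    by (simp add: p_def coeff_sum flip: q_def)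
qed

lemma poly_add_power_CARD: "(a + b) ^ CARD('f) = a ^ CARD('f) + (b :: 'f :: finite_field poly) ^ CARD('f)"
proof -
  define q where "q = CARD('f)"
  have q: "q > 0" by (simp add: q_def finite_UNIV_card_ge_0)
  have 0: "(of_nat (q choose i) :: 'f poly) = 0" if "i \<in> {1..<q}" for i
    using of_nat_CARD_choose_eq_0[of i, where 'f = 'f] that by (simp add: q_def of_nat_poly)
  have "{..q} = insert 0 (insert q {1..<q})" using q by auto
  then have "(a + b) ^ q = a ^ q + b ^ q"
    using q by (simp add: binomial_ring 0)
  then show ?thesis by (simp add: q_def)
qed

lemma poly_add_power_CARD_power:
  "(a + b) ^ (CARD('f) ^ n) = a ^ (CARD('f) ^ n) + (b :: 'f :: finite_field poly) ^ (CARD('f) ^ n)"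
proof (induction n)
  case (Suc n)
  have *: "x ^ (CARD('f) ^ Suc n) = (x ^ (CARD('f) ^ n)) ^ CARD('f)" for x :: "'f poly"
    by (simp add: mult.commute flip: power_mult)
  show ?case unfolding * Suc.IH by (rule poly_add_power_CARD)
qed simp

lemma poly_sum_power_CARD_power:
  "(\<Sum>i\<in>S. f i :: 'f :: finite_field poly) ^ (CARD('f) ^ n) = (\<Sum>i\<in>S. f i ^ (CARD('f) ^ n))"
  by (induction S rule: infinite_finite_induct)
     (simp_all add: poly_add_power_CARD_power power_0_left)

text \<open>
  The elements of \<open>A{\<tau>}\<close>, for \<open>A = \<bbbF>[t]\<close>, are given by their
  left coefficients: \<open>c\<close> stands for \<open>\<Sum>i. c i \<tau>\<^sup>i\<close>.  The relation
  \<open>\<tau> c = c\<^sup>q \<tau>\<close> forces \<open>(a \<tau>\<^sup>i)(b \<tau>\<^sup>j) = a b^(q^i) \<tau>\<^sup>(\<^sup>i\<^sup>+\<^sup>j\<^sup>)\<close>.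
\<close>

typedef (overloaded) 'f tpoly = "{c :: nat \<Rightarrow> 'f :: finite_field poly. finite {i. c i \<noteq> 0}}"
  morphisms tcoeff Abs_tpoly
  by (rule exI[of _ "\<lambda>_. 0"]) simp

setup_lifting type_definition_tpoly

lemma finite_tcoeff: "finite {i. tcoeff f i \<noteq> 0}"
  using tcoeff[of f] by simp

lemma tpoly_eqI: "(\<And>i. tcoeff f i = tcoeff g i) \<Longrightarrow> f = g"
  by (simp add: tcoeff_inject[symmetric] fun_eq_iff)

instantiation tpoly :: (finite_field) ring_1
begin

lift_definition zero_tpoly :: "'a tpoly" is "\<lambda>_. 0" by simp

lift_definition one_tpoly :: "'a tpoly" is "\<lambda>i. if i = 0 then 1 else 0" by simp

lift_definition plus_tpoly :: "'a tpoly \<Rightarrow> 'a tpoly \<Rightarrow> 'a tpoly" is "\<lambda>a b i. a i + b i"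
  by (erule (1) finite_subset[rotated, OF finite_UnI]) auto

lift_definition minus_tpoly :: "'a tpoly \<Rightarrow> 'a tpoly \<Rightarrow> 'a tpoly" is "\<lambda>a b i. a i - b i"
  by (erule (1) finite_subset[rotated, OF finite_UnI]) auto

lift_definition uminus_tpoly :: "'a tpoly \<Rightarrow> 'a tpoly" is "\<lambda>a i. - a i" by simp

lift_definition times_tpoly :: "'a tpoly \<Rightarrow> 'a tpoly \<Rightarrow> 'a tpoly" is
  "\<lambda>a b n. \<Sum>i\<le>n. a i * b (n - i) ^ (CARD('a) ^ i)"
proof -
  fix a b :: "nat \<Rightarrow> 'a poly"
  assume fin: "finite {i. a i \<noteq> 0}" "finite {i. b i \<noteq> 0}"
  have "{n. (\<Sum>i\<le>n. a i * b (n - i) ^ (CARD('a) ^ i)) \<noteq> 0}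
      \<subseteq> (\<lambda>(i, j). i + j) ` ({i. a i \<noteq> 0} \<times> {i. b i \<noteq> 0})"
  proof
    fix n assume "n \<in> {n. (\<Sum>i\<le>n. a i * b (n - i) ^ (CARD('a) ^ i)) \<noteq> 0}"
    then obtain i where "i \<le> n" "a i * b (n - i) ^ (CARD('a) ^ i) \<noteq> 0"
      by (auto elim: sum.not_neutral_contains_not_neutral)
    then show "n \<in> (\<lambda>(i, j). i + j) ` ({i. a i \<noteq> 0} \<times> {i. b i \<noteq> 0})"
      by (intro image_eqI[of _ _ "(i, n - i)"]) (auto simp: power_0_left)
  qed
  then show "finite {n. (\<Sum>i\<le>n. a i * b (n - i) ^ (CARD('a) ^ i)) \<noteq> 0}"
    using fin by (blast intro: finite_subset)
qed

instance
proof
  fix a b c :: "'a tpoly"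
  show "a * b * c = a * (b * c)"
  proof (rule tpoly_eqI)
    fix n
    let ?q = "CARD('a)"
    have "tcoeff (a * b * c) n =
        (\<Sum>j\<le>n. \<Sum>i\<le>j. tcoeff a i * tcoeff b (j - i) ^ (?q ^ i) * tcoeff c (n - j) ^ (?q ^ j))"
      by (simp add: times_tpoly.rep_eq sum_distrib_right)
    also have "\<dots> = (\<Sum>(j, i)\<in>(SIGMA j:{..n}. {..j}).
        tcoeff a i * tcoeff b (j - i) ^ (?q ^ i) * tcoeff c (n - j) ^ (?q ^ j))"
      by (simp add: sum.Sigma)
    also have "\<dots> = (\<Sum>(i, k)\<in>(SIGMA i:{..n}. {..n - i}).
        tcoeff a i * tcoeff b k ^ (?q ^ i) * tcoeff c (n - (i + k)) ^ (?q ^ (i + k)))"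
      by (rule sum.reindex_bij_witness[of _ "\<lambda>(i, k). (i + k, i)" "\<lambda>(j, i). (i, j - i)"]) auto
    also have "\<dots> = (\<Sum>i\<le>n. \<Sum>k\<le>n - i.
        tcoeff a i * (tcoeff b k * tcoeff c (n - i - k) ^ (?q ^ k)) ^ (?q ^ i))"
      by (simp add: sum.Sigma power_mult_distrib mult.assoc power_add mult.commute
               flip: power_mult)
    also have "\<dots> = tcoeff (a * (b * c)) n"
      by (simp add: times_tpoly.rep_eq poly_sum_power_CARD_power sum_distrib_left)
    finally show "tcoeff (a * b * c) n = tcoeff (a * (b * c)) n" .
  qed
  have eq: "(if i = 0 then 1 else 0) * x = (if i = 0 then x else 0)" for i :: nat and x :: "'a poly"
    by simp
  show "1 * a = a"
    by (rule tpoly_eqI) (simp add: times_tpoly.rep_eq one_tpoly.rep_eq eq)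
  show "a * 1 = a"
  proof (rule tpoly_eqI)
    fix n
    have "tcoeff (a * 1) n = (\<Sum>i\<le>n. if i = n then tcoeff a i else 0)"
      unfolding times_tpoly.rep_eq one_tpoly.rep_eq
      by (rule sum.cong) (auto simp: power_0_left)
    then show "tcoeff (a * 1) n = tcoeff a n" by simp
  qed
  show "(a + b) * c = a * c + b * c"
    by (rule tpoly_eqI)
       (simp add: times_tpoly.rep_eq plus_tpoly.rep_eq distrib_right sum.distrib)
  show "a * (b + c) = a * b + a * c"
    by (rule tpoly_eqI)
       (simp add: times_tpoly.rep_eq plus_tpoly.rep_eq poly_add_power_CARD_power
         distrib_left sum.distrib)
  show "(0 :: 'a tpoly) \<noteq> 1"
    by transfer (auto simp: fun_eq_iff)
qed (transfer; simp add: fun_eq_iff algebra_simps)+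

end

definition tconst :: "'f :: finite_field poly \<Rightarrow> 'f tpoly" where
  "tconst c = Abs_tpoly (\<lambda>i. if i = 0 then c else 0)"

lemma tcoeff_tconst: "tcoeff (tconst c) = (\<lambda>i. if i = 0 then c else 0)"
  by (simp add: tconst_def Abs_tpoly_inverse)

lift_definition tau :: "'f :: finite_field tpoly" is
  "\<lambda>i. if i = 1 then 1 else 0" by simp

lemma tau_mult_tconst: "tau * tconst c = tconst (c ^ CARD('f)) * (tau :: 'f :: finite_field tpoly)"
proof (rule tpoly_eqI)
  fix n
  have "tcoeff (tau * tconst c) n = (\<Sum>i\<le>n. if i = 1 then if n = 1 then c ^ CARD('f) else 0 else 0)"
    unfolding times_tpoly.rep_eq tau.rep_eq tcoeff_tconst
    by (rule sum.cong) (auto simp: power_0_left)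
  moreover have "tcoeff (tconst (c ^ CARD('f)) * tau) n =
      (\<Sum>i\<le>n. if i = 0 then if n = 1 then c ^ CARD('f) else 0 else 0)"
    unfolding times_tpoly.rep_eq tau.rep_eq tcoeff_tconst
    by (rule sum.cong) (auto simp: power_0_left)
  ultimately show "tcoeff (tau * tconst c) n = tcoeff (tconst (c ^ CARD('f)) * tau) n"
    by simp
qed

definition tact :: "'f :: finite_field tpoly \<Rightarrow> 'f poly \<Rightarrow> 'f poly" where
  "tact f x = (\<Sum>i | tcoeff f i \<noteq> 0. tcoeff f i * x ^ (CARD('f) ^ i))"

definition falg_hom :: "('f :: finite_field poly \<Rightarrow> 'f tpoly) \<Rightarrow> bool" where
  "falg_hom \<phi> \<longleftrightarrow>
     (\<forall>a b. \<phi> (a + b) = \<phi> a + \<phi> b) \<and>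
     (\<forall>a b. \<phi> (a * b) = \<phi> a * \<phi> b) \<and>
     (\<forall>c. \<phi> [:c:] = tconst [:c:])"

text \<open>
  \<open>drinfeld_model n \<phi>\<close> says \<open>\<phi>\<^sub>t = t + g\<^sub>1 \<tau> + \<dots> + g\<^sub>n \<tau>\<^sup>n\<close> with
  \<open>g\<^sub>n \<noteq> 0\<close>, where \<open>t = [:0, 1:]\<close>.  For \<open>n = 0\<close> the last condition is vacuous
  and \<open>\<phi>\<close> is the model with \<open>\<phi>\<^sub>t = t\<close>, of rank 0.
\<close>

definition drinfeld_model :: "nat \<Rightarrow> ('f :: finite_field poly \<Rightarrow> 'f tpoly) \<Rightarrow> bool" where
  "drinfeld_model n \<phi> \<longleftrightarrow> falg_hom \<phi> \<and>
     tcoeff (\<phi> [:0, 1:]) 0 = [:0, 1:] \<and>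
     tcoeff (\<phi> [:0, 1:]) n \<noteq> 0 \<and> (\<forall>i>n. tcoeff (\<phi> [:0, 1:]) i = 0)"

definition small :: "('f :: finite_field poly \<Rightarrow> 'f tpoly) \<Rightarrow> bool" where
  "small \<phi> \<longleftrightarrow> (\<forall>i\<ge>1. degree (tcoeff (\<phi> [:0, 1:]) i) \<le> CARD('f) ^ i)"

text \<open>
  The set \<open>\<Omega>\<^sub>r\<close> contains the degenerate model \<open>\<phi>\<^sub>t = t\<close>: it corresponds to
  all tuples \<open>(g\<^sub>1, \<dots>, g\<^sub>r)\<close> with \<open>deg g\<^sub>i \<le> q^i\<close>, so that its cardinality is a power of \<open>q\<close>.
  Without the degenerate model, no event of \<open>\<Omega>\<^sub>r\<close> could have probability \<open>1 / q^d\<close> with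
  \<open>d > 0\<close>, the number of outcomes being prime to \<open>q\<close>.
\<close>

definition small_models :: "nat \<Rightarrow> ('f :: finite_field poly \<Rightarrow> 'f tpoly) set" where
  "small_models r = {\<phi>. (\<exists>n\<le>r. drinfeld_model n \<phi>) \<and> small \<phi>}"

definition place :: "'f :: field poly \<Rightarrow> bool" where
  "place p \<longleftrightarrow> lead_coeff p = 1 \<and> irreducible p"

definition principal_ideal :: "'a :: comm_ring_1 \<Rightarrow> 'a set" where
  "principal_ideal a = {b. a dvd b}"

definition annih ::
  "'f :: finite_field poly \<Rightarrow> ('f poly \<Rightarrow> 'f tpoly) \<Rightarrow> 'f poly set \<Rightarrow> 'f poly set" where
  "annih x \<phi> I = {a. tact (\<phi> a) x \<in> I}"

definition wieferich ::
  "('f :: finite_field poly \<Rightarrow> 'f tpoly) \<Rightarrow> 'f poly \<Rightarrow> 'f poly \<Rightarrow> bool" where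
  "wieferich \<phi> x p \<longleftrightarrow>
     annih x \<phi> (principal_ideal p) = annih x \<phi> (principal_ideal (p ^ 2))"

lemma falg_hom_eqI:
  assumes "falg_hom \<phi>" "falg_hom \<psi>" "\<phi> [:0, 1:] = \<psi> [:0, 1:]"
  shows "\<phi> = \<psi>"
proof
  fix a show "\<phi> a = \<psi> a"
  proof (induction a)
    case 0
    have "\<phi> [:0:] = \<psi> [:0:]" using assms unfolding falg_hom_def by metis
    then show ?case by simp
  next
    case (pCons c a)
    have "pCons c a = [:c:] + [:0, 1:] * a" by simp
    then show ?case using assms pCons.IH unfolding falg_hom_def by metis
  qed
qed

lemma finite_degree_le: "finite {p :: 'a :: {finite, zero} poly. degree p \<le> n}"
proof (rule finite_subset)
  show "{p :: 'a poly. degree p \<le> n} \<subseteq> Poly ` {xs. set xs \<subseteq> UNIV \<and> length xs \<le> Suc n}"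
  proof
    fix p :: "'a poly" assume "p \<in> {p. degree p \<le> n}"
    then have "length (coeffs p) \<le> Suc n"
      by (cases "p = 0") (simp_all add: length_coeffs_degree)
    then show "p \<in> Poly ` {xs. set xs \<subseteq> UNIV \<and> length xs \<le> Suc n}"
      by (intro image_eqI[of _ _ "coeffs p"]) simp_all
  qed
  show "finite (Poly ` {xs :: 'a list. set xs \<subseteq> UNIV \<and> length xs \<le> Suc n})"
    by (intro finite_imageI finite_lists_length_le) simp
qed

lemma finite_small_models: "finite (small_models r :: ('f :: finite_field poly \<Rightarrow> 'f tpoly) set)"
proof (rule finite_imageD)
  let ?c = "\<lambda>\<phi> :: 'f poly \<Rightarrow> 'f tpoly. tcoeff (\<phi> [:0, 1:])"
  let ?B = "{p :: 'f poly. degree p \<le> CARD('f) ^ r}"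
  let ?S = "{f. \<forall>i. (i \<in> {..r} \<longrightarrow> f i \<in> ?B) \<and> (i \<notin> {..r} \<longrightarrow> f i = 0)}"
  have q: "CARD('f) \<ge> 1" by (simp add: Suc_le_eq finite_UNIV_card_ge_0)
  have "?c ` small_models r \<subseteq> ?S"
  proof
    fix c assume "c \<in> ?c ` small_models r"
    then obtain \<phi> :: "'f poly \<Rightarrow> 'f tpoly" where \<phi>: "\<phi> \<in> small_models r" and c: "c = ?c \<phi>"
      by blast
    have "degree (?c \<phi> i) \<le> CARD('f) ^ r" if "i \<le> r" for i
    proof (cases "i = 0")
      case True
      then show ?thesis using \<phi> q by (auto simp: small_models_def drinfeld_model_def)
    next
      case False
      then have "degree (?c \<phi> i) \<le> CARD('f) ^ i"
        using \<phi> by (auto simp: small_models_def small_def)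
      also have "\<dots> \<le> CARD('f) ^ r" using that q by (intro power_increasing) auto
      finally show ?thesis .
    qed
    moreover have "?c \<phi> i = 0" if "\<not> i \<le> r" for i
      using \<phi> that by (auto simp: small_models_def drinfeld_model_def)
    ultimately show "c \<in> ?S" by (simp add: c)
  qed
  moreover have "finite ?S"
    by (rule finite_set_of_finite_funs) (auto intro: finite_degree_le)
  ultimately show "finite (?c ` small_models r)" by (rule finite_subset)
  show "inj_on ?c (small_models r)"
    by (auto simp: inj_on_def small_models_def drinfeld_model_def tcoeff_inject intro: falg_hom_eqI)
qed

lemma small_models_nonempty: "(small_models r :: ('f :: finite_field poly \<Rightarrow> 'f tpoly) set) \<noteq> {}"
proof -
  have mult: "tconst (a * b) = tconst a * tconst b" for a b :: "'f poly"
  proof (rule tpoly_eqI)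
    fix n
    have "tcoeff (tconst a * tconst b) n = (\<Sum>i\<le>n. if i = 0 then if n = 0 then a * b else 0 else 0)"
      unfolding times_tpoly.rep_eq tcoeff_tconst
      by (rule sum.cong) (auto simp: power_0_left)
    then show "tcoeff (tconst (a * b)) n = tcoeff (tconst a * tconst b) n"
      by (simp add: tcoeff_tconst)
  qed
  have add: "tconst (a + b) = tconst a + tconst b" for a b :: "'f poly"
    by (rule tpoly_eqI) (simp add: tcoeff_tconst plus_tpoly.rep_eq)
  have "drinfeld_model 0 (tconst :: 'f poly \<Rightarrow> _)" "small (tconst :: 'f poly \<Rightarrow> _)"
    by (simp_all add: drinfeld_model_def falg_hom_def small_def mult add tcoeff_tconst)
  then have "tconst \<in> (small_models r :: ('f poly \<Rightarrow> 'f tpoly) set)"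
    by (auto simp: small_models_def)
  then show ?thesis by blast
qed

end

theory Submission
  imports Defs "HOL-Number_Theory.Cong"
begin

text \<open>
  Let \<open>x\<^sub>0 = 1, x\<^sub>1 = \<phi>\<^sub>t(1), x\<^sub>2 = \<phi>\<^sub>t(x\<^sub>1), \<dots>\<close>, so that \<open>\<phi>\<^sub>a(1)\<close> is the combination of the \<open>x\<^sub>i\<close>
  with the coefficients of \<open>a\<close>.  The annihilator of \<open>1\<close> modulo \<open>p\<close> is generated by a monic \<open>a\<close> of some
  degree \<open>1 \<le> m \<le> d\<close>, and \<open>p\<close> is Wieferich iff \<open>p\<^sup>2\<close> divides \<open>\<phi>\<^sub>a(1)\<close>.  Since \<open>x\<^sub>0, \<dots>, x\<^sub>m\<^sub>-\<^sub>1\<close> are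
  linearly independent modulo \<open>p\<close>, there is an additive polynomial \<open>H = \<Sum> H\<^sub>i \<tau>\<^sup>i\<close>, with \<open>i\<close> ranging over
  \<open>r - d < i \<le> r\<close>, that vanishes modulo \<open>p\<close> at \<open>x\<^sub>0, \<dots>, x\<^sub>m\<^sub>-\<^sub>2\<close> and is \<open>1\<close> at \<open>x\<^sub>m\<^sub>-\<^sub>1\<close>.  Replacing \<open>\<phi>\<^sub>t\<close>
  by \<open>\<phi>\<^sub>t + p (c H mod p)\<close> changes nothing modulo \<open>p\<close> and keeps \<open>\<phi>\<close> small, because
  \<open>2 d \<le> q^(r - d)\<close>; and it changes \<open>\<phi>\<^sub>a(1)\<close> by \<open>p c\<close> modulo \<open>p\<^sup>2\<close>.  Hence exactly one of the \<open>q^d\<close>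
  residues \<open>c\<close> yields a Wieferich model.
\<close>

subsection \<open>Additive polynomials\<close>

lemma CARD_finite_field_ge_2: "CARD('f :: finite_field) \<ge> 2"
proof -
  have "card {0, 1 :: 'f} \<le> CARD('f)" by (rule card_mono) auto
  then show ?thesis by simp
qed

text \<open>The additive polynomial with coefficients \<open>h 0, ..., h n\<close>. The explicit
  bound \<open>n\<close> makes sums range over a fixed interval; values of \<open>h\<close> beyond
  \<open>n\<close> are ignored.\<close>

definition qpoly :: "nat \<Rightarrow> (nat \<Rightarrow> 'f poly) \<Rightarrow> 'f :: finite_field poly \<Rightarrow> 'f poly" where
  "qpoly n h y = (\<Sum>i\<le>n. h i * y ^ (CARD('f) ^ i))"

lemma qpoly_add: "qpoly n h (x + y) = qpoly n h x + qpoly n h y"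
  by (simp add: qpoly_def poly_add_power_CARD_power distrib_left sum.distrib)

lemma const_power_CARD_power: "[:c:] ^ (CARD('f) ^ n) = [:c :: 'f :: finite_field:]"
  by (simp add: poly_const_pow finite_field_power_card_power_eq_same)

lemma smult_power_CARD_power:
  "smult c y ^ (CARD('f) ^ n) = smult (c :: 'f :: finite_field) (y ^ (CARD('f) ^ n))"
  by (simp add: smult_power finite_field_power_card_power_eq_same)

lemma smult_sum_right: "smult c (\<Sum>i\<in>S. f i) = (\<Sum>i\<in>S. smult c (f i))"
  by (induction S rule: infinite_finite_induct) (simp_all add: smult_add_right)

lemma qpoly_smult: "qpoly n h (smult c y) = smult c (qpoly n h y)"
  by (simp add: qpoly_def smult_power_CARD_power smult_sum_right)

lemma qpoly_diff: "qpoly n h (x - y) = qpoly n h x - qpoly n h y"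
  using qpoly_add[of n h "x - y" y] by (simp add: algebra_simps)

lemma qpoly_sum: "qpoly n h (\<Sum>i\<in>S. f i) = (\<Sum>i\<in>S. qpoly n h (f i))"
proof -
  have "qpoly n h 0 = 0" using qpoly_diff[of n h 0 0] by simp
  then show ?thesis
    by (induction S rule: infinite_finite_induct) (simp_all add: qpoly_add)
qed

lemma cong_qpoly:
  assumes "\<And>i. i \<le> n \<Longrightarrow> [g i = h i] (mod p)" "[x = y] (mod p)"
  shows "[qpoly n g x = qpoly n h y] (mod p)"
  unfolding qpoly_def using assms by (intro cong_sum cong_mult cong_pow) auto

text \<open>Homogeneous form of the product of all \<open>X - c\<close> being
  \<open>X^q - X\<close>. For \<open>b \<noteq> 0\<close> both sides, as polynomials in
  \<open>a\<close>, are monic of degree \<open>q\<close> with the \<open>q\<close> distinct roots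
  \<open>smult c b\<close>.\<close>

lemma prod_diff_smult:
  fixes a b :: "'f :: finite_field poly"
  shows "(\<Prod>c\<in>UNIV. a - smult c b) = a ^ CARD('f) - b ^ (CARD('f) - 1) * a"
proof (cases "b = 0")
  case True
  then show ?thesis using CARD_finite_field_ge_2[where 'f = 'f] by simp
next
  case False
  define q where "q = CARD('f)"
  have q: "q \<ge> 2" unfolding q_def by (rule CARD_finite_field_ge_2)
  define P :: "'f poly poly" where
    "P = monom 1 q - monom (b ^ (q - 1)) 1 - (\<Prod>c\<in>UNIV. [:- smult c b, 1:])"
  have deg: "degree (\<Prod>c\<in>UNIV. [:- smult c b, 1:] :: 'f poly poly) = q"
    by (subst degree_prod_sum_eq) (auto simp: q_def)
  have lead: "coeff (\<Prod>c\<in>UNIV. [:- smult c b, 1:] :: 'f poly poly) q = 1"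
    using lead_coeff_prod[of "\<lambda>c. [:- smult c b, 1:]" "UNIV :: 'f set"] deg by simp
  have "P = 0"
  proof (rule ccontr)
    assume "P \<noteq> 0"
    have root: "poly P (smult c b) = 0" for c :: 'f
    proof -
      have "b ^ (q - 1) * b = b ^ q" using q by (metis One_nat_def Suc_1 Suc_leD Suc_le_lessD power_minus_mult)
      moreover have "smult c b ^ q = smult c (b ^ q)"
        by (simp add: smult_power q_def finite_field_power_card_eq_same)
      moreover have "(\<Prod>x\<in>UNIV. poly [:- smult x b, 1:] (smult c b)) = 0"
        by (rule prod_zero) auto
      ultimately show ?thesis
        by (simp add: P_def poly_monom poly_prod)
    qed
    have "degree P \<le> q" unfolding P_def
      using deg q by (intro degree_diff_le) (auto intro: order.trans[OF degree_monom_le])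
    moreover have "coeff P q = 0" using q lead by (simp add: P_def)
    \<comment> \<open>The leading terms cancel, so \<open>P\<close> has too small a degree for its
      \<open>q\<close> roots.\<close>
    ultimately have "degree P < q"
      using \<open>P \<noteq> 0\<close> by (metis leading_coeff_0_iff order_le_less)
    moreover have "range (\<lambda>c. smult c b) \<subseteq> {x. poly P x = 0}" using root by auto
    then have "card (range (\<lambda>c. smult c b)) \<le> card {x. poly P x = 0}"
      by (intro card_mono) (simp_all add: poly_roots_finite \<open>P \<noteq> 0\<close>)
    moreover have "card (range (\<lambda>c. smult c b)) = q"
      unfolding q_def
    proof (intro card_image injI)
      fix c c' :: 'f assume "smult c b = smult c' b"
      then have "smult (c - c') b = 0" by (simp add: smult_diff_left)
      with False show "c = c'" by simp
    qed
    moreover have "card {x. poly P x = 0} \<le> degree P"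
      using \<open>P \<noteq> 0\<close> by (rule card_poly_roots_bound)
    ultimately show False by linarith
  qed
  then have "poly P a = 0" by simp
  then show ?thesis by (simp add: P_def poly_monom poly_prod q_def)
qed

text \<open>
  The additive polynomial with kernel \<open>V = span(x\<^sub>0, \<dots>, x\<^sub>n\<^sub>-\<^sub>1)\<close> modulo \<open>p\<close>, built by Ore's
  recursion \<open>P\<^sub>V\<^sub>+\<^sub>F\<^sub>b(y) = P\<^sub>V(y)^q - P\<^sub>V(b)^(q - 1) P\<^sub>V(y) = \<Prod>\<^sub>c (P\<^sub>V(y) - c P\<^sub>V(b))\<close>.
\<close>

lemma exists_qpoly_kernel_span:
  fixes p :: "'f :: finite_field poly"
  assumes p: "prime_elem p"
  shows "\<exists>h. (\<forall>i<n. p dvd qpoly n h (x i)) \<and>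
    (\<forall>w. p dvd qpoly n h w \<longrightarrow> (\<exists>a. p dvd w - (\<Sum>i<n. smult (a i) (x i))))"
proof (induction n)
  case 0
  \<comment> \<open>For the zero space the identity polynomial \<open>y\<close> serves.\<close>
  show ?case by (intro exI[of _ "\<lambda>_. 1"]) (simp add: qpoly_def)
next
  case (Suc n)
  then obtain h where h: "\<And>i. i < n \<Longrightarrow> p dvd qpoly n h (x i)"
    and hs: "\<And>w. p dvd qpoly n h w \<Longrightarrow> \<exists>a. p dvd w - (\<Sum>i<n. smult (a i) (x i))" by blast
  define b where "b = qpoly n h (x n)"
  \<comment> \<open>Coefficients of the recursion: raising to the power \<open>q\<close> shifts
    indices by one, hence the case split. The guard \<open>j \<le> n\<close> is there because
    \<open>h\<close> is unconstrained beyond \<open>n\<close>.\<close>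
  define h' where "h' j = (case j of 0 \<Rightarrow> 0 | Suc j \<Rightarrow> h j ^ CARD('f))
     - (if j \<le> n then b ^ (CARD('f) - 1) * h j else 0)" for j
  have eq: "qpoly (Suc n) h' y = qpoly n h y ^ CARD('f) - b ^ (CARD('f) - 1) * qpoly n h y" for y
  proof -
    have "qpoly (Suc n) h' y =
        (\<Sum>j\<le>Suc n. (case j of 0 \<Rightarrow> 0 | Suc j \<Rightarrow> h j ^ CARD('f)) * y ^ (CARD('f) ^ j))
        - (\<Sum>j\<le>Suc n. (if j \<le> n then b ^ (CARD('f) - 1) * h j else 0) * y ^ (CARD('f) ^ j))"
      by (simp only: qpoly_def h'_def left_diff_distrib sum_subtractf)
    also have "(\<Sum>j\<le>Suc n. (case j of 0 \<Rightarrow> 0 | Suc j \<Rightarrow> h j ^ CARD('f)) * y ^ (CARD('f) ^ j))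
        = (\<Sum>j\<le>n. (h j * y ^ (CARD('f) ^ j)) ^ CARD('f))"
      by (subst sum.atMost_Suc_shift)
         (simp add: power_mult_distrib mult.commute flip: power_mult)
    also have "\<dots> = qpoly n h y ^ CARD('f)"
      using poly_sum_power_CARD_power[of "\<lambda>j. h j * y ^ (CARD('f) ^ j)" "{..n}" 1]
      by (simp add: qpoly_def)
    also have "(\<Sum>j\<le>Suc n. (if j \<le> n then b ^ (CARD('f) - 1) * h j else 0) * y ^ (CARD('f) ^ j))
        = b ^ (CARD('f) - 1) * qpoly n h y"
      by (simp add: qpoly_def sum_distrib_left mult.assoc)
    finally show ?thesis .
  qed
  show ?case
  proof (intro exI[of _ h'] conjI allI impI)
    fix i assume "i < Suc n"
    show "p dvd qpoly (Suc n) h' (x i)"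
    proof (cases "i = n")
      case True
      have "b ^ (CARD('f) - 1) * b = b ^ CARD('f)"
        by (rule power_minus_mult) (simp add: finite_UNIV_card_ge_0)
      then show ?thesis unfolding eq True b_def[symmetric] by simp
    next
      case False
      with \<open>i < Suc n\<close> have "p dvd qpoly n h (x i)" by (intro h) simp
      then show ?thesis unfolding eq
        by (intro dvd_diff dvd_mult) (auto intro: dvd_trans[OF _ dvd_power] simp: finite_UNIV_card_ge_0)
    qed
  next
    fix w assume "p dvd qpoly (Suc n) h' w"
    \<comment> \<open>The factored form lets primality of \<open>p\<close> single out one
      \<open>c\<close>, the coefficient of the new vector \<open>x n\<close>.\<close>
    then have "p dvd (\<Prod>c\<in>UNIV. qpoly n h w - smult c b)" unfolding eq prod_diff_smult .
    then obtain c where "p dvd qpoly n h w - smult c b"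
      unfolding prod_unfold_prod_mset by (rule prime_elem_dvd_prod_msetE[OF p]) auto
    then have "p dvd qpoly n h (w - smult c (x n))" by (simp add: qpoly_diff qpoly_smult b_def)
    from hs[OF this] obtain a where "p dvd w - smult c (x n) - (\<Sum>i<n. smult (a i) (x i))" by blast
    then have "p dvd w - (\<Sum>i<Suc n. smult ((a(n := c)) i) (x i))" by (simp add: algebra_simps)
    then show "\<exists>a. p dvd w - (\<Sum>i<Suc n. smult (a i) (x i))" by blast
  qed
qed

subsection \<open>Annihilators modulo a prime\<close>

lemma cong_smult: "[x = y] (mod p) \<Longrightarrow> [smult c x = smult c y] (mod (p :: 'a :: field poly))"
  using cong_scalar_left[of x y p "[:c:]"] by simp

lemma degree_mod_less_pos:
  fixes p :: "'a :: field poly"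
  assumes "degree p > 0"
  shows "degree (c mod p) < degree p"
proof -
  have "p \<noteq> 0" using assms by auto
  from degree_mod_less[OF this, of c] assms show ?thesis by auto
qed

text \<open>Multiplication by \<open>b\<close> is injective on the finite set of reduced residues,
  hence surjective, so it hits 1.\<close>

lemma inverse_mod_prime_poly:
  fixes p b :: "'f :: finite_field poly"
  assumes p: "prime_elem p" and b: "\<not> p dvd b"
  shows "\<exists>b'. [b' * b = 1] (mod p)"
proof -
  have p0: "p \<noteq> 0" using p by auto
  have dp: "degree p > 0"
    using p p0 by (metis is_unit_iff_degree gr0I prime_elem_not_unit)
  let ?R = "{c :: 'f poly. degree c < degree p}"
  have fin: "finite ?R" by (rule finite_subset[OF _ finite_degree_le[of "degree p"]]) auto
  have "inj_on (\<lambda>c. c * b mod p) ?R"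
  proof (rule inj_onI)
    fix c c' assume R: "c \<in> ?R" "c' \<in> ?R" and eq: "c * b mod p = c' * b mod p"
    have "p dvd (c - c') * b" using eq by (simp add: mod_eq_dvd_iff left_diff_distrib)
    then have "p dvd c - c'" using b p by (auto simp: prime_elem_dvd_mult_iff)
    moreover have "degree (c - c') < degree p" using R by (intro degree_diff_less) auto
    ultimately show "c = c'" by (metis dvd_imp_degree_le eq_iff_diff_eq_0 not_less)
  qed
  moreover have "(\<lambda>c. c * b mod p) ` ?R \<subseteq> ?R" using degree_mod_less_pos[OF dp] by auto
  ultimately have "(\<lambda>c. c * b mod p) ` ?R = ?R" using fin by (intro endo_inj_surj) auto
  moreover have "1 \<in> ?R" using dp by simp
  ultimately obtain b' where "b' * b mod p = 1" by (metis (no_types, lifting) imageE)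
  then show ?thesis using dp by (intro exI[of _ b']) (simp add: cong_def mod_poly_less)
qed

text \<open>The linear map over the constants that sends \<open>t^i\<close> to
  \<open>x i\<close>.\<close>

definition lin_comb :: "(nat \<Rightarrow> 'a poly) \<Rightarrow> 'a :: comm_ring_1 poly \<Rightarrow> 'a poly" where
  "lin_comb x a = (\<Sum>i\<le>degree a. smult (coeff a i) (x i))"

lemma lin_comb_altdef:
  assumes "degree a \<le> n"
  shows "lin_comb x a = (\<Sum>i\<le>n. smult (coeff a i) (x i))"
  unfolding lin_comb_def using assms
  by (intro sum.mono_neutral_left) (auto simp: coeff_eq_0)

lemma lin_comb_diff: "lin_comb x (a - b) = lin_comb x a - lin_comb x b"
proof -
  let ?n = "max (degree a) (degree b)"
  show ?thesis
    by (simp add: lin_comb_altdef[of _ ?n] degree_diff_le smult_diff_left sum_subtractf)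
qed

lemma lin_comb_smult: "lin_comb x (smult c a) = smult c (lin_comb x a)"
  using degree_smult_le[of c a]
  by (simp add: lin_comb_altdef[of _ "degree a"] smult_sum_right)

lemma lin_comb_pCons: "lin_comb x (pCons c a) = smult c (x 0) + lin_comb (\<lambda>i. x (Suc i)) a"
proof -
  have "degree (pCons c a) \<le> Suc (degree a)" by (rule degree_pCons_le)
  then have "lin_comb x (pCons c a) = (\<Sum>i\<le>Suc (degree a). smult (coeff (pCons c a) i) (x i))"
    by (rule lin_comb_altdef)
  then show ?thesis by (simp add: lin_comb_def sum.atMost_Suc_shift del: sum.atMost_Suc)
qed

lemma cong_lin_comb:
  assumes "\<And>n. n \<le> degree a \<Longrightarrow> [x n = y n] (mod p)"
  shows "[lin_comb x a = lin_comb y a] (mod (p :: 'a :: field poly))"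
  unfolding lin_comb_def using assms by (intro cong_sum cong_smult) auto

text \<open>Pigeonhole: there are more polynomials of degree at most \<open>degree p\<close> than
  residues modulo \<open>p\<close>, so two of them have congruent values and their difference
  annihilates. An annihilator of least degree is then made monic; it is not constant because
  \<open>p\<close> does not divide \<open>x 0\<close>.\<close>

lemma exists_minimal_annihilator:
  fixes p :: "'f :: finite_field poly"
  assumes p: "p \<noteq> 0" and x0: "\<not> p dvd x 0"
  shows "\<exists>a. lead_coeff a = 1 \<and> 0 < degree a \<and> degree a \<le> degree p \<and> p dvd lin_comb x a \<and>
    (\<forall>b. b \<noteq> 0 \<longrightarrow> p dvd lin_comb x b \<longrightarrow> degree a \<le> degree b)"
proof -
  have dp: "degree p > 0"
    using p x0 by (metis is_unit_iff_degree gr0I unit_imp_dvd)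
  let ?R = "{c :: 'f poly. degree c < degree p}" and ?S = "{c :: 'f poly. degree c \<le> degree p}"
  have fin: "finite ?S" by (rule finite_degree_le)
  have "(\<lambda>c. lin_comb x c mod p) ` ?S \<subseteq> ?R"
    using degree_mod_less_pos[OF dp] by auto
  then have "card ((\<lambda>c. lin_comb x c mod p) ` ?S) \<le> card ?R"
    by (rule card_mono[rotated]) (rule finite_subset[OF _ fin], auto)
  also have "card ?R < card ?S" using fin by (rule psubset_card_mono) auto
  finally have "\<not> inj_on (\<lambda>c. lin_comb x c mod p) ?S" by (metis card_image less_irrefl)
  then obtain b b' where b: "degree b \<le> degree p" "degree b' \<le> degree p" "b \<noteq> b'"
    and eq: "lin_comb x b mod p = lin_comb x b' mod p"
    unfolding inj_on_def by blast
  let ?P = "\<lambda>b. b \<noteq> 0 \<and> p dvd lin_comb x b"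
  have P: "?P (b - b')" using b eq by (simp add: lin_comb_diff mod_eq_dvd_iff)
  obtain a where a: "?P a" "\<And>c. ?P c \<Longrightarrow> degree a \<le> degree c"
    using ex_has_least_nat[of ?P "b - b'" degree] P by blast
  define a' where "a' = smult (inverse (lead_coeff a)) a"
  have deg: "degree a' = degree a" using a by (simp add: a'_def)
  have lead: "lead_coeff a' = 1" using a by (simp add: a'_def)
  have dvd: "p dvd lin_comb x a'" using a by (simp add: a'_def lin_comb_smult dvd_smult)
  have "degree a' > 0"
  proof (rule gr0I)
    assume "degree a' = 0"
    with lead have "a' = [:1:]" by (metis degree_eq_zeroE lead_coeff_pCons(2) pCons_0_0 lead_coeff_pCons(1))
    with dvd have "p dvd x 0" by (simp add: lin_comb_def)
    with x0 show False by simp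
  qed
  moreover have "degree a' \<le> degree p"
    using a(2)[OF P] b degree_diff_le[of b "degree p" b'] deg by linarith
  ultimately show ?thesis using lead dvd a(2) deg by (intro exI[of _ a']) auto
qed

text \<open>
  Raising the polynomial that vanishes on \<open>x\<^sub>0, \<dots>, x\<^sub>m\<^sub>-\<^sub>2\<close> to the power \<open>q^(k + 1)\<close> moves its
  exponents into the window from \<open>q^(k + 1)\<close> to \<open>q^(k + d)\<close> without changing its zeros.
\<close>

lemma exists_dual_qpoly:
  fixes p :: "'f :: finite_field poly"
  assumes p: "prime_elem p" and m: "0 < m" "m \<le> d"
    and min: "\<And>b. b \<noteq> 0 \<Longrightarrow> p dvd lin_comb x b \<Longrightarrow> m \<le> degree b"
  shows "\<exists>H. (\<forall>i. i \<le> k \<or> k + d < i \<longrightarrow> H i = 0) \<and>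
    (\<forall>n<m. [qpoly (k + d) H (x n) = (if Suc n = m then 1 else 0)] (mod p))"
proof -
  obtain n where n: "m = Suc n" using m(1) by (cases m) auto
  obtain h where h: "\<And>i. i < n \<Longrightarrow> p dvd qpoly n h (x i)"
    and hs: "\<And>w. p dvd qpoly n h w \<Longrightarrow> \<exists>a. p dvd w - (\<Sum>i<n. smult (a i) (x i))"
    using exists_qpoly_kernel_span[OF p, of n x] by blast
  have "\<not> p dvd qpoly n h (x n)"
  proof
    assume "p dvd qpoly n h (x n)"
    from hs[OF this] obtain a where a: "p dvd x n - (\<Sum>i<n. smult (a i) (x i))" by blast
    \<comment> \<open>If \<open>x n\<close> lay in the span modulo \<open>p\<close>, this
      \<open>b\<close> would be a nonzero annihilator of degree at most
      \<open>n < m\<close>.\<close>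
    define b where "b = monom 1 n - (\<Sum>i<n. monom (a i) i)"
    have cb: "coeff b j = (if j = n then 1 else if j < n then - a j else 0)" for j
      by (auto simp: b_def coeff_sum)
    have db: "degree b \<le> n" by (rule degree_le) (simp add: cb)
    have "lin_comb x b = x n - (\<Sum>i<n. smult (a i) (x i))"
      unfolding lin_comb_altdef[OF db] lessThan_Suc_atMost[symmetric]
      by (simp add: cb sum_negf)
    moreover have "b \<noteq> 0" using cb[of n] by auto
    ultimately have "m \<le> degree b" using a min by metis
    with db n show False by simp
  qed
  let ?Q = "CARD('f) ^ Suc k"
  have Q: "?Q > 0" by (simp add: finite_UNIV_card_ge_0)
  have "\<not> p dvd qpoly n h (x n) ^ ?Q"
    using \<open>\<not> p dvd qpoly n h (x n)\<close> prime_elem_dvd_power[OF p] by blast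
  then obtain b where b: "[b * qpoly n h (x n) ^ ?Q = 1] (mod p)"
    using inverse_mod_prime_poly[OF p] by blast
  \<comment> \<open>The coefficients of \<open>b\<close> times the \<open>q^(k + 1)\<close>-th power
    of the kernel polynomial. The top index is \<open>k + 1 + n = k + m\<close>, at most
    \<open>k + d\<close>.\<close>
  define H where "H i = (if k < i \<and> i \<le> Suc k + n then b * h (i - Suc k) ^ ?Q else 0)" for i
  have eq: "qpoly (k + d) H y = b * qpoly n h y ^ ?Q" for y
  proof -
    have "qpoly (k + d) H y = (\<Sum>i\<in>{Suc k..Suc k + n}. b * h (i - Suc k) ^ ?Q * y ^ (CARD('f) ^ i))"
      unfolding qpoly_def by (rule sum.mono_neutral_cong_right) (use m n in \<open>auto simp: H_def\<close>)
    also have "\<dots> = (\<Sum>j\<le>n. b * h j ^ ?Q * y ^ (CARD('f) ^ (j + Suc k)))"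
      by (rule sum.reindex_bij_witness[of _ "\<lambda>j. j + Suc k" "\<lambda>i. i - Suc k"]) auto
    also have "\<dots> = (\<Sum>j\<le>n. b * (h j * y ^ (CARD('f) ^ j)) ^ ?Q)"
      by (simp only: power_mult_distrib mult.assoc power_add power_mult)
    also have "\<dots> = b * qpoly n h y ^ ?Q"
      by (simp only: qpoly_def poly_sum_power_CARD_power sum_distrib_left)
    finally show ?thesis .
  qed
  show ?thesis
  proof (intro exI[of _ H] conjI allI impI)
    fix j assume "j < m"
    show "[qpoly (k + d) H (x j) = (if Suc j = m then 1 else 0)] (mod p)"
    proof (cases "Suc j = m")
      case True
      with b n show ?thesis by (simp add: eq)
    next
      case False
      with \<open>j < m\<close> n have "p dvd qpoly n h (x j)" by (intro h) simp
      then have "p dvd qpoly n h (x j) ^ ?Q" using Q by (metis dvd_power dvd_trans)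
      with False show ?thesis by (simp add: eq cong_0_iff)
    qed
  qed (use m n in \<open>auto simp: H_def\<close>)
qed

subsection \<open>Twisted polynomials and their action\<close>

lemma tact_eq_qpoly:
  assumes "\<And>i. i > n \<Longrightarrow> tcoeff f i = 0"
  shows "tact f x = qpoly n (tcoeff f) x"
  unfolding tact_def qpoly_def
  by (rule sum.mono_neutral_left) (use assms in \<open>auto simp: not_le[symmetric]\<close>)

lemma tcoeff_eventually_0: "\<exists>n. \<forall>i>n. tcoeff f i = 0"
proof -
  obtain n where "\<forall>i\<in>{i. tcoeff f i \<noteq> 0}. i \<le> n"
    using finite_tcoeff[of f] by (auto simp: finite_nat_set_iff_bounded_le)
  then show ?thesis by (intro exI[of _ n]) force
qed

lemma tact_add: "tact (f + g) x = tact f x + tact g x"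
proof -
  obtain m n where "\<forall>i>m. tcoeff f i = 0" "\<forall>i>n. tcoeff g i = 0"
    using tcoeff_eventually_0 by metis
  then have "tact h x = qpoly (max m n) (tcoeff h) x" if "h \<in> {f, g, f + g}" for h
    using that by (intro tact_eq_qpoly) (auto simp: plus_tpoly.rep_eq)
  then show ?thesis
    by (simp add: qpoly_def plus_tpoly.rep_eq distrib_right sum.distrib)
qed

lemma tact_tconst: "tact (tconst c) x = c * x"
  by (subst tact_eq_qpoly[of 0]) (auto simp: qpoly_def tcoeff_tconst)

lemma tact_mult: "tact (f * g) x = tact f (tact g x)"
proof -
  let ?q = "CARD('a)"
  obtain m n where m: "\<forall>i>m. tcoeff f i = 0" and n: "\<forall>i>n. tcoeff g i = 0"
    using tcoeff_eventually_0 by metis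
  have 0: "tcoeff f i * tcoeff g (k - i) ^ ?q ^ i = 0" if "i > m \<or> k - i > n" for i k
    using that m n by (auto simp: power_0_left)
  have iter: "(x ^ ?q ^ j) ^ ?q ^ i = x ^ ?q ^ (i + j)" for i j
    by (simp add: power_add mult.commute flip: power_mult)
  have "tcoeff (f * g) k = 0" if "k > m + n" for k
    unfolding times_tpoly.rep_eq using that by (intro sum.neutral ballI 0) auto
  then have "tact (f * g) x = (\<Sum>k\<le>m + n. \<Sum>i\<le>k. tcoeff f i * tcoeff g (k - i) ^ ?q ^ i * x ^ ?q ^ k)"
    by (subst tact_eq_qpoly[of "m + n"]) (auto simp: qpoly_def times_tpoly.rep_eq sum_distrib_right)
  also have "\<dots> = (\<Sum>(k, i)\<in>(SIGMA k:{..m + n}. {..k}).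
      tcoeff f i * tcoeff g (k - i) ^ ?q ^ i * x ^ ?q ^ k)"
    by (simp add: sum.Sigma)
  \<comment> \<open>Terms outside the supports of \<open>f\<close> and \<open>g\<close> vanish; what
    remains is a rectangle in the coordinates \<open>(i, k - i)\<close>.\<close>
  also have "\<dots> = (\<Sum>(k, i)\<in>{(k, i). i \<le> k \<and> i \<le> m \<and> k - i \<le> n}.
      tcoeff f i * tcoeff g (k - i) ^ ?q ^ i * x ^ ?q ^ k)"
  proof (rule sum.mono_neutral_right)
    show "\<forall>z\<in>(SIGMA k:{..m + n}. {..k}) - {(k, i). i \<le> k \<and> i \<le> m \<and> k - i \<le> n}.
      (case z of (k, i) \<Rightarrow> tcoeff f i * tcoeff g (k - i) ^ ?q ^ i * x ^ ?q ^ k) = 0"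
    proof
      fix z assume z: "z \<in> (SIGMA k:{..m + n}. {..k}) - {(k, i). i \<le> k \<and> i \<le> m \<and> k - i \<le> n}"
      obtain k i where ki: "z = (k, i)" by (cases z)
      have "i > m \<or> k - i > n" using z by (auto simp: ki)
      from 0[OF this] show "(case z of (k, i) \<Rightarrow>
          tcoeff f i * tcoeff g (k - i) ^ ?q ^ i * x ^ ?q ^ k) = 0"
        by (simp add: ki)
    qed
  qed auto
  also have "\<dots> = (\<Sum>(i, j)\<in>{..m} \<times> {..n}. tcoeff f i * tcoeff g j ^ ?q ^ i * x ^ ?q ^ (i + j))"
    by (rule sum.reindex_bij_witness[of _ "\<lambda>(i, j). (i + j, i)" "\<lambda>(k, i). (i, k - i)"]) auto
  also have "\<dots> = (\<Sum>i\<le>m. \<Sum>j\<le>n. tcoeff f i * (tcoeff g j * x ^ ?q ^ j) ^ ?q ^ i)"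
    by (simp add: sum.cartesian_product power_mult_distrib mult.assoc iter)
  also have "\<dots> = tact f (tact g x)"
    by (subst tact_eq_qpoly[of m], use m in blast, subst tact_eq_qpoly[of n], use n in blast)
       (simp add: qpoly_def poly_sum_power_CARD_power sum_distrib_left)
  finally show ?thesis .
qed

lemma dvd_tact: "d dvd x \<Longrightarrow> d dvd tact f (x :: 'f :: finite_field poly)"
  unfolding tact_def
  by (intro dvd_sum dvd_mult) (auto intro: dvd_trans[OF _ dvd_power] simp: finite_UNIV_card_ge_0)

section \<open>The orbit of 1 and the Wieferich criterion\<close>

definition orbit :: "nat \<Rightarrow> (nat \<Rightarrow> 'f poly) \<Rightarrow> nat \<Rightarrow> 'f :: finite_field poly" where
  "orbit r g n = (qpoly r g ^^ n) 1"

lemma orbit_0 [simp]: "orbit r g 0 = 1"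
  and orbit_Suc [simp]: "orbit r g (Suc n) = qpoly r g (orbit r g n)"
  by (simp_all add: orbit_def)

lemma falg_hom_0: "falg_hom \<phi> \<Longrightarrow> \<phi> 0 = 0"
  unfolding falg_hom_def by (metis add_cancel_right_right)

lemma tact_0: "tact 0 x = 0"
  by (simp add: tact_def zero_tpoly.rep_eq)

text \<open>Horner induction: the action of \<open>\<phi> [:0, 1:]\<close> is linear over the
  constants, so it passes inside the combination and shifts the orbit by one.\<close>

lemma tact_falg_hom_eq_lin_comb:
  fixes \<phi> :: "'f :: finite_field poly \<Rightarrow> 'f tpoly"
  assumes \<phi>: "falg_hom \<phi>" and r: "\<And>i. i > r \<Longrightarrow> tcoeff (\<phi> [:0, 1:]) i = 0"
  shows "tact (\<phi> a) 1 = lin_comb (orbit r (tcoeff (\<phi> [:0, 1:]))) a"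
proof (induction a)
  case 0
  show ?case by (simp add: falg_hom_0[OF \<phi>] tact_0 lin_comb_def)
next
  case (pCons c a)
  let ?g = "tcoeff (\<phi> [:0, 1:])"
  have "pCons c a = [:c:] + [:0, 1:] * a" by simp
  then have "\<phi> (pCons c a) = tconst [:c:] + \<phi> [:0, 1:] * \<phi> a"
    using \<phi> unfolding falg_hom_def by metis
  then have "tact (\<phi> (pCons c a)) 1 = [:c:] + qpoly r ?g (lin_comb (orbit r ?g) a)"
    by (simp add: tact_add tact_mult tact_tconst pCons.IH tact_eq_qpoly[OF r])
  also have "qpoly r ?g (lin_comb (orbit r ?g) a) = lin_comb (\<lambda>i. orbit r ?g (Suc i)) a"
    by (simp add: lin_comb_def qpoly_sum qpoly_smult)
  finally show ?case by (simp add: lin_comb_pCons)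
qed

text \<open>Divide an annihilator \<open>b\<close> by \<open>a\<close>: the remainder annihilates
  too and is zero by minimality. So the value at \<open>b\<close> is a twisted polynomial applied to
  the value at \<open>a\<close>, which preserves divisibility by \<open>p ^ 2\<close>.\<close>

lemma wieferich_iff:
  fixes \<phi> :: "'f :: finite_field poly \<Rightarrow> 'f tpoly"
  assumes \<phi>: "falg_hom \<phi>"
    and a: "a \<noteq> 0" "p dvd tact (\<phi> a) x"
    and min: "\<And>b. b \<noteq> 0 \<Longrightarrow> p dvd tact (\<phi> b) x \<Longrightarrow> degree a \<le> degree b"
  shows "wieferich \<phi> x p \<longleftrightarrow> p ^ 2 dvd tact (\<phi> a) x"
proof
  assume "wieferich \<phi> x p"
  with a show "p ^ 2 dvd tact (\<phi> a) x"
    unfolding wieferich_def annih_def principal_ideal_def by blast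
next
  assume a2: "p ^ 2 dvd tact (\<phi> a) x"
  have mult: "tact (\<phi> (c * a)) x = tact (\<phi> c) (tact (\<phi> a) x)" for c
    using \<phi> by (simp add: falg_hom_def tact_mult)
  have "p ^ 2 dvd tact (\<phi> b) x" if b: "p dvd tact (\<phi> b) x" for b
  proof -
    have eq: "\<phi> b = \<phi> (b mod a) + \<phi> (b div a * a)"
      using \<phi> unfolding falg_hom_def by (metis mod_div_mult_eq)
    have "p dvd tact (\<phi> (b mod a)) x"
      using b dvd_tact[OF a(2), of "\<phi> (b div a)"]
      by (simp add: eq tact_add mult dvd_add_left_iff)
    then have "b mod a = 0"
      using min[of "b mod a"] degree_mod_less[OF a(1), of b] by linarith
    then show ?thesis
      using dvd_tact[OF a2, of "\<phi> (b div a)"]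
      by (simp add: eq falg_hom_0[OF \<phi>] tact_add tact_0 mult)
  qed
  then show "wieferich \<phi> x p"
    unfolding wieferich_def annih_def principal_ideal_def
    by (auto intro: dvd_trans[of p "p ^ 2"] simp: power2_eq_square)
qed

section \<open>Small models and their coefficient sequences\<close>

lemma tconst_commute: "tconst [:c:] * f = f * tconst [:c :: 'f :: finite_field:]"
proof (rule tpoly_eqI)
  fix n
  have "tcoeff (tconst [:c:] * f) n = (\<Sum>i\<le>n. if i = 0 then [:c:] * tcoeff f n else 0)"
    unfolding times_tpoly.rep_eq tcoeff_tconst by (rule sum.cong) auto
  moreover have "tcoeff (f * tconst [:c:]) n = (\<Sum>i\<le>n. if i = n then [:c:] * tcoeff f n else 0)"
    unfolding times_tpoly.rep_eq tcoeff_tconst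
    by (rule sum.cong) (auto simp: power_0_left const_power_CARD_power)
  ultimately show "tcoeff (tconst [:c:] * f) n = tcoeff (f * tconst [:c:]) n" by simp
qed

lemma tconst_0: "tconst 0 = 0"
  by (rule tpoly_eqI) (simp add: tcoeff_tconst zero_tpoly.rep_eq)

lemma tconst_1: "tconst [:1:] = 1"
  by (rule tpoly_eqI) (simp add: tcoeff_tconst one_tpoly.rep_eq one_pCons)

lemma tconst_add: "tconst (a + b) = tconst a + tconst b"
  by (rule tpoly_eqI) (simp add: tcoeff_tconst plus_tpoly.rep_eq)

lemma tconst_mult: "tconst (a * b) = tconst a * tconst b"
proof (rule tpoly_eqI)
  fix n
  have "tcoeff (tconst a * tconst b) n = (\<Sum>i\<le>n. if i = 0 then if n = 0 then a * b else 0 else 0)"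
    unfolding times_tpoly.rep_eq tcoeff_tconst
    by (rule sum.cong) (auto simp: power_0_left)
  then show "tcoeff (tconst (a * b)) n = tcoeff (tconst a * tconst b) n"
    by (simp add: tcoeff_tconst)
qed

text \<open>Evaluation at \<open>f\<close> by Horner's scheme. It is multiplicative although the
  target is not commutative, because elements of the finite field are fixed by the
  \<open>q\<close>-th power and so are central.\<close>

lemma exists_falg_hom:
  fixes f :: "'f :: finite_field tpoly"
  shows "\<exists>\<phi>. falg_hom \<phi> \<and> \<phi> [:0, 1:] = f"
proof -
  define \<phi> where "\<phi> a = fold_coeffs (\<lambda>c g. tconst [:c:] + f * g) a 0" for a
  have 0: "\<phi> 0 = 0" by (simp add: \<phi>_def)
  have pC: "\<phi> (pCons c a) = tconst [:c:] + f * \<phi> a" for c a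
    by (cases "c = 0 \<and> a = 0") (auto simp: \<phi>_def tconst_0)
  have const: "\<phi> [:c:] = tconst [:c:]" for c by (simp add: pC 0)
  have add: "\<phi> (a + b) = \<phi> a + \<phi> b" for a b
  proof (induction a b rule: poly_induct2)
    case (pCons c a d b)
    have "tconst [:c + d:] = tconst [:c:] + tconst [:d:]"
      using tconst_add[of "[:c:]" "[:d:]"] by simp
    then show ?case by (simp add: pC pCons.IH distrib_left)
  qed (simp add: 0)
  have smult: "\<phi> (smult c a) = tconst [:c:] * \<phi> a" for c a
  proof (induction a)
    case (pCons d a)
    have "tconst [:c * d:] = tconst [:c:] * tconst [:d:]"
      using tconst_mult[of "[:c:]" "[:d:]"] by (simp add: mult.commute)
    moreover have "f * (tconst [:c:] * \<phi> a) = tconst [:c:] * (f * \<phi> a)"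
      by (metis mult.assoc tconst_commute)
    ultimately show ?case by (simp add: pC pCons.IH distrib_left)
  qed (simp add: 0)
  have mult: "\<phi> (a * b) = \<phi> a * \<phi> b" for a b
  proof (induction a)
    case (pCons c a)
    then show ?case by (simp add: pC add smult tconst_0 distrib_right mult.assoc)
  qed (simp add: 0)
  have "\<phi> [:0, 1:] = f"
    by (simp add: pC 0 tconst_0 tconst_1)
  with add mult const show ?thesis unfolding falg_hom_def by blast
qed

text \<open>The top coefficients may vanish, so all ranks up to \<open>r\<close> are covered at
  once.\<close>

definition coeff_funs :: "nat \<Rightarrow> (nat \<Rightarrow> 'f :: finite_field poly) set" where
  "coeff_funs r = {g. g 0 = [:0, 1:] \<and> (\<forall>i>r. g i = 0) \<and> (\<forall>i\<ge>1. degree (g i) \<le> CARD('f) ^ i)}"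

lemma small_models_imp_falg_hom: "\<phi> \<in> small_models r \<Longrightarrow> falg_hom \<phi>"
  by (auto simp: small_models_def drinfeld_model_def)

lemma bij_betw_small_models_coeff_funs:
  "bij_betw (\<lambda>\<phi> :: 'f :: finite_field poly \<Rightarrow> 'f tpoly. tcoeff (\<phi> [:0, 1:]))
     (small_models r) (coeff_funs r)"
proof (rule bij_betwI')
  fix \<phi> \<psi> :: "'f poly \<Rightarrow> 'f tpoly"
  assume "\<phi> \<in> small_models r" "\<psi> \<in> small_models r"
  then show "(tcoeff (\<phi> [:0, 1:]) = tcoeff (\<psi> [:0, 1:])) = (\<phi> = \<psi>)"
    by (auto simp: tcoeff_inject intro: falg_hom_eqI small_models_imp_falg_hom)
next
  fix \<phi> :: "'f poly \<Rightarrow> 'f tpoly" assume "\<phi> \<in> small_models r"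
  then show "tcoeff (\<phi> [:0, 1:]) \<in> coeff_funs r"
    by (auto simp: small_models_def drinfeld_model_def small_def coeff_funs_def)
next
  fix g :: "nat \<Rightarrow> 'f poly" assume g: "g \<in> coeff_funs r"
  have "{i. g i \<noteq> 0} \<subseteq> {..r}" using g by (auto simp: coeff_funs_def) (meson not_le)
  then have fin: "finite {i. g i \<noteq> 0}" by (rule finite_subset) simp
  then have tg: "tcoeff (Abs_tpoly g) = g" by (simp add: Abs_tpoly_inverse)
  obtain \<phi> where \<phi>: "falg_hom \<phi>" "\<phi> [:0, 1:] = Abs_tpoly g" using exists_falg_hom by blast
  \<comment> \<open>The rank is the last index with a nonzero coefficient; it exists because
    \<open>g 0\<close> is \<open>t\<close>, and it may be 0.\<close>
  define n where "n = Max {i. g i \<noteq> 0}"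
  have g0: "g 0 \<noteq> 0" using g by (simp add: coeff_funs_def)
  have "g n \<noteq> 0" using Max_in[OF fin] g0 unfolding n_def by blast
  moreover have "\<forall>i>n. g i = 0" using Max_ge[OF fin] unfolding n_def by (force simp: not_le[symmetric])
  moreover have "n \<le> r" using \<open>g n \<noteq> 0\<close> \<open>{i. g i \<noteq> 0} \<subseteq> {..r}\<close> by auto
  ultimately have "\<phi> \<in> small_models r"
    using \<phi> tg g by (auto simp: small_models_def drinfeld_model_def small_def coeff_funs_def)
  then show "\<exists>\<phi>\<in>small_models r. g = tcoeff (\<phi> [:0, 1:])" using \<phi> tg by metis
qed

subsection \<open>Counting Wieferich models\<close>

text \<open>Phrased by vanishing coefficients instead of the degree so that the induction can start
  at \<open>n = 0\<close> with the zero polynomial.\<close>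

lemma finite_card_poly_coeff_eq_0:
  "finite {c :: 'f :: finite_field poly. \<forall>i\<ge>n. coeff c i = 0} \<and>
   card {c :: 'f poly. \<forall>i\<ge>n. coeff c i = 0} = CARD('f) ^ n"
proof (induction n)
  case 0
  have "{c :: 'f poly. \<forall>i\<ge>0. coeff c i = 0} = {0}" by (auto simp: poly_eq_iff)
  then show ?case by simp
next
  case (Suc n)
  let ?P = "\<lambda>n. {c :: 'f poly. \<forall>i\<ge>n. coeff c i = 0}"
  have "bij_betw (\<lambda>(a, c). pCons a c) (UNIV \<times> ?P n) (?P (Suc n))"
  proof (rule bij_betw_imageI)
    show "(\<lambda>(a, c). pCons a c) ` (UNIV \<times> ?P n) = ?P (Suc n)"
    proof safe
      fix a :: 'f and c :: "'f poly" and i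
      assume "\<forall>i\<ge>n. coeff c i = 0" "Suc n \<le> i"
      then show "coeff (pCons a c) i = 0" by (cases i) auto
    next
      fix c :: "'f poly" assume c: "\<forall>i\<ge>Suc n. coeff c i = 0"
      obtain a c' where eq: "c = pCons a c'" by (cases c)
      have "coeff c' i = 0" if "i \<ge> n" for i
        using c[rule_format, of "Suc i"] that by (simp add: eq)
      then show "c \<in> (\<lambda>(a, c). pCons a c) ` (UNIV \<times> ?P n)" using eq by auto
    qed
  qed (auto simp: inj_on_def)
  with Suc.IH show ?case
    by (auto dest: bij_betw_same_card simp: bij_betw_finite[symmetric] card_cartesian_product)
qed

lemma card_degree_less:
  assumes "n > 0"
  shows "card {c :: 'f :: finite_field poly. degree c < n} = CARD('f) ^ n"
proof -
  have "{c :: 'f poly. degree c < n} = {c. \<forall>i\<ge>n. coeff c i = 0}"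
  proof safe
    fix c :: "'f poly" assume c: "\<forall>i\<ge>n. coeff c i = 0"
    have "degree c \<le> n - 1" by (rule degree_le) (use c in auto)
    with assms show "degree c < n" by simp
  qed (simp add: coeff_eq_0)
  then show ?thesis using finite_card_poly_coeff_eq_0[of n, where 'f = 'f] by simp
qed

text \<open>
  All members of \<open>B\<close> share the generator \<open>a\<close> of the annihilator of \<open>1\<close> modulo \<open>p\<close>.  The residues
  \<open>c\<close> modulo \<open>p\<close> act freely on \<open>B\<close> by \<open>sh\<close>, which moves the value \<open>\<phi>\<^sub>a(1)\<close>, a multiple of \<open>p\<close>,
  by \<open>p c\<close> modulo \<open>p\<^sup>2\<close>; so each orbit contains exactly one Wieferich member.
\<close>

lemma card_block:
  fixes p a :: "'f :: finite_field poly" and k x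
  defines "B \<equiv> {g \<in> coeff_funs (k + degree p). \<forall>n. [orbit (k + degree p) g n = x n] (mod p)}"
  assumes p: "prime_elem p" and k: "2 * degree p \<le> CARD('f) ^ k"
    and a: "lead_coeff a = 1" "0 < degree a" "degree a \<le> degree p" "p dvd lin_comb x a"
    and min: "\<And>b. b \<noteq> 0 \<Longrightarrow> p dvd lin_comb x b \<Longrightarrow> degree a \<le> degree b"
  shows "card (B) = CARD('f) ^ degree p *
    card {g \<in> B. p ^ 2 dvd lin_comb (orbit (k + degree p) g) a}"
proof -
  define d r m where "d = degree p" and "r = k + d" and "m = degree a"
  note defs = d_def[symmetric] r_def[symmetric] m_def[symmetric]
  have d: "d > 0" using a by (simp add: d_def)
  have p0: "p \<noteq> 0" using p by auto
  obtain H where H0: "\<And>i. i \<le> k \<or> r < i \<Longrightarrow> H i = 0"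
    and H: "\<And>n. n < m \<Longrightarrow> [qpoly r H (x n) = (if Suc n = m then 1 else 0)] (mod p)"
    using exists_dual_qpoly[OF p a(2,3) min, where k = k] unfolding defs by blast
  \<comment> \<open>Reduction modulo \<open>p\<close> bounds the degree of each correction, and the
    factor \<open>p\<close> makes it invisible modulo \<open>p\<close>. The correction is additive
    in \<open>c\<close> and depends only on \<open>c\<close> modulo \<open>p\<close>.\<close>
  define sh where "sh g c i = g i + p * (c * H i mod p)" for g :: "nat \<Rightarrow> 'f poly" and c i
  let ?W = "{g \<in> B. p ^ 2 dvd lin_comb (orbit r g) a}" and ?R = "{c :: 'f poly. degree c < d}"
  have memB: "g \<in> B \<longleftrightarrow> g \<in> coeff_funs r \<and> (\<forall>n. [orbit r g n = x n] (mod p))" for g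
    by (simp add: B_def defs)

  have sh_cong: "sh g c = sh g c'" if "[c = c'] (mod p)" for g c c'
    using cong_scalar_right[OF that] by (simp add: sh_def cong_def fun_eq_iff)
  have sh_sh: "sh (sh g c) c' = sh g (c + c')" for g c c'
    by (simp add: sh_def fun_eq_iff distrib_right distrib_left poly_mod_add_left)
  have sh_0: "sh g 0 = g" for g by (simp add: sh_def fun_eq_iff)
  have sh_coeff: "sh g c \<in> coeff_funs r" if g: "g \<in> coeff_funs r" for g c
  proof -
    have "degree (sh g c i) \<le> CARD('f) ^ i" if i: "i \<ge> 1" for i
    proof -
      have "degree (p * (c * H i mod p)) \<le> CARD('f) ^ i"
      proof (cases "i \<le> k")
        case True
        then show ?thesis by (simp add: H0)
      next
        case False
        have "degree (p * (c * H i mod p)) \<le> d + degree (c * H i mod p)"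
          unfolding d_def by (rule degree_mult_le)
        also have "\<dots> \<le> 2 * d"
          using degree_mod_less_pos[of p "c * H i"] d by (simp add: d_def)
        also have "\<dots> \<le> CARD('f) ^ k" using k by (simp add: d_def)
        also have "\<dots> \<le> CARD('f) ^ i" using False
          by (intro power_increasing) (auto simp: Suc_le_eq finite_UNIV_card_ge_0)
        finally show ?thesis .
      qed
      with g i show ?thesis unfolding sh_def by (intro degree_add_le) (auto simp: coeff_funs_def)
    qed
    with g show ?thesis by (auto simp: coeff_funs_def) (auto simp: sh_def H0)
  qed
  have sh_orbit: "[orbit r (sh g c) n = orbit r g n] (mod p)" for g c n
  proof (induction n)
    case (Suc n)
    have "[sh g c i = g i] (mod p)" for i by (simp add: sh_def cong_iff_dvd_diff)
    with Suc show ?case unfolding orbit_Suc by (intro cong_qpoly)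
  qed simp
  have sh_B: "sh g c \<in> B" if "g \<in> B" for g c
    using that sh_coeff sh_orbit cong_trans unfolding memB by blast

  \<comment> \<open>The first change modulo \<open>p ^ 2\<close> appears at index \<open>m\<close>:
    \<open>H\<close> vanishes modulo \<open>p\<close> at the earlier points and is 1 at
    \<open>x (m - 1)\<close>.\<close>
  have sh_orbit2: "[orbit r (sh g c) n = orbit r g n + (if n = m then p * c else 0)] (mod p ^ 2)"
    if g: "g \<in> B" and "n \<le> m" for g c n
    using \<open>n \<le> m\<close>
  proof (induction n)
    case 0
    then show ?case using a by (simp add: m_def)
  next
    case (Suc n)
    let ?h = "\<lambda>i. c * H i mod p"
    have "[qpoly r ?h (orbit r g n) = qpoly r (\<lambda>i. c * H i) (x n)] (mod p)"
      using g by (intro cong_qpoly) (auto simp: memB)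
    also have "qpoly r (\<lambda>i. c * H i) (x n) = c * qpoly r H (x n)"
      by (simp add: qpoly_def sum_distrib_left mult.assoc)
    also have "[c * qpoly r H (x n) = c * (if Suc n = m then 1 else 0)] (mod p)"
      using Suc.prems by (intro cong_scalar_left H) simp
    \<comment> \<open>The factor \<open>p\<close> turns a congruence modulo \<open>p\<close> into
      one modulo \<open>p ^ 2\<close>; hence \<open>H\<close> need only be controlled modulo
      \<open>p\<close>.\<close>
    finally have *: "[p * qpoly r ?h (orbit r g n) = p * (c * (if Suc n = m then 1 else 0))] (mod p ^ 2)"
      unfolding power2_eq_square by (rule cong_cmult_leftI)
    have "[orbit r (sh g c) (Suc n) = qpoly r (sh g c) (orbit r g n)] (mod p ^ 2)"
      using Suc by (auto intro!: cong_qpoly)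
    also have "qpoly r (sh g c) (orbit r g n) = orbit r g (Suc n) + p * qpoly r ?h (orbit r g n)"
      by (simp add: qpoly_def sh_def distrib_right sum.distrib sum_distrib_left mult.assoc)
    also have "[\<dots> = orbit r g (Suc n) + p * (c * (if Suc n = m then 1 else 0))] (mod p ^ 2)"
      by (intro cong_add * cong_refl)
    finally show ?case by (auto split: if_splits)
  qed
  have sh_lin: "[lin_comb (orbit r (sh g c)) a = lin_comb (orbit r g) a + p * c] (mod p ^ 2)"
    if g: "g \<in> B" for g c
  proof -
    \<comment> \<open>Only the term of index \<open>m\<close> moves, and its coefficient is 1
      because \<open>a\<close> is monic.\<close>
    have "lin_comb (\<lambda>n. orbit r g n + (if n = m then p * c else 0)) a
        = lin_comb (orbit r g) a + (\<Sum>n\<le>m. if n = m then p * c else 0)"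
      unfolding lin_comb_def smult_add_right sum.distrib
      using a by (intro arg_cong2[of _ _ _ _ "(+)"] sum.cong) (auto simp: m_def)
    then show ?thesis using cong_lin_comb[of a "orbit r (sh g c)", OF sh_orbit2[OF g]]
      by (simp add: m_def)
  qed

  have "bij_betw (\<lambda>(g, c). sh g c) (?W \<times> ?R) (B)"
  proof (rule bij_betw_imageI)
    show "inj_on (\<lambda>(g, c). sh g c) (?W \<times> ?R)"
    proof (rule inj_onI, clarify)
      fix g c g' c'
      assume g: "g \<in> B" "p ^ 2 dvd lin_comb (orbit r g) a" and c: "degree c < d"
        and g': "g' \<in> B" "p ^ 2 dvd lin_comb (orbit r g') a" and c': "degree c' < d"
        and eq: "sh g c = sh g' c'"
      \<comment> \<open>Two Wieferich members in one orbit differ by the shift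
        \<open>c - c'\<close>, which must then be divisible by \<open>p\<close>.\<close>
      have g'_eq: "g' = sh g (c - c')"
        using arg_cong[OF eq, of "\<lambda>h. sh h (- c')"] by (simp add: sh_sh sh_0)
      have "p ^ 2 dvd lin_comb (orbit r g) a + p * (c - c')"
        using cong_dvd_iff[OF sh_lin[OF g(1), of "c - c'"]] g'(2) g'_eq by simp
      then have "p * p dvd p * (c - c')"
        using g(2) by (simp add: dvd_add_right_iff power2_eq_square)
      then have "p dvd c - c'" using p0 by (simp only: dvd_mult_cancel_left) simp
      moreover have "degree (c - c') < d" using c c' by (rule degree_diff_less)
      ultimately have "c = c'" unfolding d_def by (metis dvd_imp_degree_le eq_iff_diff_eq_0 not_less)
      with g'_eq show "g = g' \<and> c = c'" by (simp add: sh_0)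
    qed
    show "(\<lambda>(g, c). sh g c) ` (?W \<times> ?R) = B"
    proof (intro equalityI subsetI)
      fix g' assume "g' \<in> (\<lambda>(g, c). sh g c) ` (?W \<times> ?R)"
      then show "g' \<in> B" using sh_B by auto
    next
      fix g' assume g': "g' \<in> B"
      then have "[lin_comb (orbit r g') a = lin_comb x a] (mod p)"
        by (intro cong_lin_comb) (simp add: memB)
      \<comment> \<open>Shifting by \<open>- u\<close> cancels the value modulo
        \<open>p ^ 2\<close>; shifting back by \<open>u mod p\<close> recovers
        \<open>g'\<close>.\<close>
      then obtain u where u: "lin_comb (orbit r g') a = p * u"
        using a(4) cong_dvd_iff by blast
      have "p ^ 2 dvd lin_comb (orbit r (sh g' (- u))) a"
        using cong_dvd_iff[OF sh_lin[OF g', of "- u"]] u by simp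
      then have "sh g' (- u) \<in> ?W" using sh_B[OF g'] by simp
      moreover have "u mod p \<in> ?R" using degree_mod_less_pos[of p u] d by (simp add: d_def)
      moreover have "sh (sh g' (- u)) (u mod p) = g'"
        using sh_cong[of "- u + u mod p" 0 g']
        by (simp add: sh_sh sh_0 cong_iff_dvd_diff mod_eq_dvd_iff[symmetric] flip: minus_mod_eq_mult_div)
      ultimately show "g' \<in> (\<lambda>(g, c). sh g c) ` (?W \<times> ?R)" by force
    qed
  qed
  then have "card (?W \<times> ?R) = card (B)" by (rule bij_betw_same_card)
  then show ?thesis
    using card_degree_less[OF d, where 'f = 'f] by (simp add: card_cartesian_product defs mult.commute)
qed

text \<open>A block fixes the whole orbit of 1 modulo \<open>p\<close>. This determines the
  annihilator of 1 modulo \<open>p\<close>, so one generator \<open>a\<close> tests every model of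
  the block.\<close>

lemma card_wieferich_block:
  fixes p :: "'f :: finite_field poly" and x k
  defines "S \<equiv> {\<phi> \<in> small_models (k + degree p).
    (\<lambda>n. orbit (k + degree p) (tcoeff (\<phi> [:0, 1:])) n mod p) = x}"
  assumes p: "prime_elem p" and k: "2 * degree p \<le> CARD('f) ^ k"
  shows "card S = CARD('f) ^ degree p * card {\<phi> \<in> S. wieferich \<phi> 1 p}"
proof (cases "S = {}")
  case True
  then show ?thesis by simp
next
  case False
  define r where "r = k + degree p"
  let ?g = "\<lambda>\<phi> :: 'f poly \<Rightarrow> 'f tpoly. tcoeff (\<phi> [:0, 1:])"
  let ?B = "{g \<in> coeff_funs r. \<forall>n. [orbit r g n = x n] (mod p)}"
  \<comment> \<open>A sequence \<open>x\<close> with nonempty block is reduced, so equality of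
    residues and congruence to \<open>x\<close> agree.\<close>
  have x: "x n mod p = x n" for n using False by (auto simp: S_def)
  have memS: "\<phi> \<in> S \<longleftrightarrow> \<phi> \<in> small_models r \<and> (\<forall>n. [orbit r (?g \<phi>) n = x n] (mod p))" for \<phi>
    using x by (simp add: S_def r_def cong_def fun_eq_iff)
  have inj: "inj_on ?g (small_models r)" and img: "?g ` small_models r = coeff_funs r"
    using bij_betw_small_models_coeff_funs[of r, where 'f = 'f] by (auto simp: bij_betw_def)
  have gS: "bij_betw ?g S ?B"
  proof (rule bij_betw_imageI)
    show "inj_on ?g S" by (rule inj_on_subset[OF inj]) (auto simp: memS)
    show "?g ` S = ?B" unfolding img[symmetric] by (auto simp: memS)
  qed
  obtain \<phi>\<^sub>0 where "\<phi>\<^sub>0 \<in> S" using False by blast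
  then have "[1 = x 0] (mod p)" unfolding memS using orbit_0 by metis
  then have "\<not> p dvd x 0" using cong_dvd_iff prime_elem_not_unit[OF p] by blast
  then obtain a where a: "lead_coeff a = 1" "0 < degree a" "degree a \<le> degree p" "p dvd lin_comb x a"
    and min: "\<And>b. b \<noteq> 0 \<Longrightarrow> p dvd lin_comb x b \<Longrightarrow> degree a \<le> degree b"
    using exists_minimal_annihilator[of p x] p by (auto simp: prime_elem_def)
  have wief: "wieferich \<phi> 1 p \<longleftrightarrow> p ^ 2 dvd lin_comb (orbit r (?g \<phi>)) a" if \<phi>: "\<phi> \<in> S" for \<phi>
  proof -
    have hom: "falg_hom \<phi>" using \<phi> small_models_imp_falg_hom by (auto simp: memS)
    have "?g \<phi> \<in> coeff_funs r" using \<phi> img by (auto simp: memS)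
    then have tact: "tact (\<phi> b) 1 = lin_comb (orbit r (?g \<phi>)) b" for b
      by (intro tact_falg_hom_eq_lin_comb[OF hom]) (auto simp: coeff_funs_def)
    have "[tact (\<phi> b) 1 = lin_comb x b] (mod p)" for b
      unfolding tact using \<phi> by (intro cong_lin_comb) (auto simp: memS)
    then have dvd: "p dvd tact (\<phi> b) 1 \<longleftrightarrow> p dvd lin_comb x b" for b by (rule cong_dvd_iff)
    have "a \<noteq> 0" using a by auto
    then have "wieferich \<phi> 1 p \<longleftrightarrow> p ^ 2 dvd tact (\<phi> a) 1"
      by (rule wieferich_iff[OF hom]) (use a min in \<open>auto simp: dvd\<close>)
    then show ?thesis by (simp add: tact)
  qed
  have "bij_betw ?g {\<phi> \<in> S. wieferich \<phi> 1 p} {g \<in> ?B. p ^ 2 dvd lin_comb (orbit r g) a}"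
  proof (rule bij_betw_imageI)
    show "inj_on ?g {\<phi> \<in> S. wieferich \<phi> 1 p}"
      using gS by (auto simp: bij_betw_def intro: inj_on_subset)
    have "?B = ?g ` S" using gS by (simp add: bij_betw_def)
    then show "?g ` {\<phi> \<in> S. wieferich \<phi> 1 p} = {g \<in> ?B. p ^ 2 dvd lin_comb (orbit r g) a}"
      using wief by auto
  qed
  from bij_betw_same_card[OF this] bij_betw_same_card[OF gS] card_block[OF p k a min]
  show ?thesis by (simp add: r_def)
qed

text \<open>The blocks partition the small models, and each contributes the same ratio.\<close>

lemma card_wieferich:
  fixes p :: "'f :: finite_field poly"
  assumes p: "prime_elem p" and k: "2 * degree p \<le> CARD('f) ^ k"
  shows "card (small_models (k + degree p) :: ('f poly \<Rightarrow> 'f tpoly) set) =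
    CARD('f) ^ degree p * card {\<phi> \<in> small_models (k + degree p). wieferich \<phi> 1 p}"
proof -
  let ?\<Omega> = "small_models (k + degree p) :: ('f poly \<Rightarrow> 'f tpoly) set"
  let ?f = "\<lambda>\<phi>. \<lambda>n. orbit (k + degree p) (tcoeff (\<phi> [:0, 1:])) n mod p"
  have fin: "finite ?\<Omega>" by (rule finite_small_models)
  have "card ?\<Omega> = (\<Sum>x\<in>?f ` ?\<Omega>. card {\<phi> \<in> ?\<Omega>. ?f \<phi> = x})"
    using sum.group[OF fin finite_imageI[OF fin] subset_refl, of "\<lambda>_. 1 :: nat" ?f] by simp
  also have "\<dots> = CARD('f) ^ degree p *
      (\<Sum>x\<in>?f ` ?\<Omega>. card {\<phi> \<in> {\<phi> \<in> ?\<Omega>. wieferich \<phi> 1 p}. ?f \<phi> = x})"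
    unfolding sum_distrib_left
    by (intro sum.cong refl trans[OF card_wieferich_block[OF p k]] arg_cong[of _ _ "\<lambda>S. _ * card S"]) auto
  also have "(\<Sum>x\<in>?f ` ?\<Omega>. card {\<phi> \<in> {\<phi> \<in> ?\<Omega>. wieferich \<phi> 1 p}. ?f \<phi> = x})
      = card {\<phi> \<in> ?\<Omega>. wieferich \<phi> 1 p}"
    using sum.group[of "{\<phi> \<in> ?\<Omega>. wieferich \<phi> 1 p}" "?f ` ?\<Omega>" ?f "\<lambda>_. 1 :: nat"] fin
    by (simp add: image_mono)
  finally show ?thesis .
qed

theorem theorem3p4:
  fixes r d :: nat and p :: "'f :: finite_field poly"
  assumes "r > 0" and "d > 0"
    and "real r \<ge> real d + log (real CARD('f)) (2 * real d)"
    and "place p" and "degree p = d"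
  shows "measure_pmf.prob (pmf_of_set (small_models r)) {\<phi>. wieferich \<phi> 1 p}
           = 1 / real CARD('f) ^ d"
proof -
  let ?\<Omega> = "small_models r :: ('f poly \<Rightarrow> 'f tpoly) set"
  have q: "real CARD('f) > 1" using CARD_finite_field_ge_2[where 'f = 'f] by linarith
  have log: "log (real CARD('f)) (2 * real d) \<le> real r - real d" using assms(3) by simp
  \<comment> \<open>Since \<open>2 * d \<ge> 1\<close> the logarithm is nonnegative, so
    \<open>r - d\<close> is a natural number \<open>k\<close>; the hypothesis on \<open>r\<close>
    then reads \<open>2 * d \<le> q^k\<close>.\<close>
  moreover have "log (real CARD('f)) (2 * real d) \<ge> 0"
    using q assms(2) by (subst zero_le_log_cancel_iff) auto
  ultimately have "d \<le> r" by linarith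
  then obtain k where k: "r = k + d" by (metis add.commute le_Suc_ex)
  have "2 * real d \<le> real CARD('f) powr real k"
    using log q assms(2) by (simp add: k log_le_iff)
  also have "\<dots> = real (CARD('f) ^ k)" using q by (simp add: powr_realpow)
  finally have "2 * degree p \<le> CARD('f) ^ k" using assms(5) by linarith
  moreover have "prime_elem p"
    using assms(4) by (simp add: place_def field_poly_irreducible_imp_prime)
  ultimately have "card ?\<Omega> = CARD('f) ^ d * card {\<phi> \<in> ?\<Omega>. wieferich \<phi> 1 p}"
    using card_wieferich[of p k] k assms(5) by simp
  moreover have "card ?\<Omega> > 0"
    using finite_small_models[where 'f = 'f, of r] small_models_nonempty[where 'f = 'f, of r]
    by (simp add: card_gt_0_iff)
  moreover have "?\<Omega> \<inter> {\<phi>. wieferich \<phi> 1 p} = {\<phi> \<in> ?\<Omega>. wieferich \<phi> 1 p}" by blast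
  ultimately show ?thesis
    using q by (simp add: measure_pmf_of_set[OF small_models_nonempty finite_small_models] field_simps)
qed

end
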